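(* For every integer $n\geq 0$, $$\sum_{j=-\infty}^\infty b_6\big(n-3j(3j-1)/2\big)\equiv 1\pmod 2$$ if and only if $n$ is a generalized octagonal number.
   Context: A partition is called $6$-regular if none of its parts is divisible by $6$; $b_6(n)$ denotes the number of $6$-regular partitions of $n$, with $b_6(0)=1$ and $b_6(n)=0$ for $n<0$. The generalized octagonal numbers are the integers of the form $k(3k-2)$ with $k\in\mathbb{Z}$ (equivalently, $m(3m\pm 2)$ with $m$ a nonnegative integer, restricted to nonnegative values). *)

theory Defs
  imports "HOL-Library.Multiset" "HOL-Library.Groups_Big_Fun" "HOL-Number_Theory.Cong"
begin

definition partitions :: "nat \<Rightarrow> nat multiset set" where
  "partitions n = {M. (\<forall>p \<in># M. p > 0) \<and> \<Sum>\<^sub># M = n}"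

definition regular_partition :: "nat \<Rightarrow> nat multiset \<Rightarrow> bool" where
  "regular_partition l M \<longleftrightarrow> (\<forall>p \<in># M. \<not> l dvd p)"

definition b6 :: "int \<Rightarrow> nat" where
  "b6 n = (if n < 0 then 0 else card {M \<in> partitions (nat n). regular_partition 6 M})"

definition generalized_octagonal :: "int \<Rightarrow> bool" where
  "generalized_octagonal n \<longleftrightarrow> (\<exists>k::int. n = k * (3 * k - 2))"

text \<open>\<open>card\<close> is 0 on infinite sets, so the next lemma is what makes \<open>b6\<close> a genuine count.\<close>

lemma finite_partitions: "finite (partitions n)"
proof -
  let ?L = "{xs. set xs \<subseteq> {..n} \<and> length xs \<le> n}"
  have "partitions n \<subseteq> mset ` ?L"
  proof
    fix M assume M: "M \<in> partitions n"
    obtain xs where xs: "M = mset xs" by (metis ex_mset)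
    have s: "sum_list xs = n" and pos: "\<forall>x\<in>set xs. x > 0"
      using M by (auto simp: partitions_def xs sum_mset_sum_list)
    have length_le: "length ys \<le> sum_list ys" if "\<forall>y\<in>set ys. y > 0" for ys :: "nat list"
      using that by (induction ys) auto
    have "\<forall>x\<in>set xs. x \<le> n"
      using s by (auto dest: member_le_sum_list)
    moreover have "length xs \<le> sum_list xs"
      using pos by (rule length_le)
    ultimately show "M \<in> mset ` ?L" using s by (auto simp: xs)
  qed
  moreover have "finite ?L" by (rule finite_lists_length_le) simp
  ultimately show ?thesis by (meson finite_imageI finite_subset)
qed

lemma b6_0: "b6 0 = 1"
proof -
  have "M = {#}" if "M \<in> partitions 0" for M
  proof (cases M)
    case (add p N)
    then show ?thesis using that by (auto simp: partitions_def)
  qed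
  then have "{M \<in> partitions 0. regular_partition 6 M} = {{#}}"
    by (auto simp: partitions_def regular_partition_def)
  then show ?thesis by (simp add: b6_def)
qed

lemma b6_neg: "n < 0 \<Longrightarrow> b6 n = 0"
  by (simp add: b6_def)

text \<open>
  \<open>Sum_any\<close> is 0 for functions of infinite support, so \<open>finite_support_b6\<close> is what makes
  the sum over all integers \<open>j\<close> the intended one. The product \<open>3 * j * (3 * j - 1)\<close> is always even,
  so the integer division by 2 is exact (\<open>three_j_exact\<close>).
\<close>

lemma three_j_exact: "2 * (3 * j * (3 * j - 1) div 2) = 3 * j * (3 * j - 1)" for j :: int
  by (rule dvd_mult_div_cancel) simp

lemma finite_support_b6: "finite {j::int. b6 (n - 3 * j * (3 * j - 1) div 2) \<noteq> 0}"
proof (rule finite_subset)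
  show "{j::int. b6 (n - 3 * j * (3 * j - 1) div 2) \<noteq> 0} \<subseteq> {-\<bar>n\<bar>..\<bar>n\<bar>}"
  proof clarify
    fix j :: int assume j: "b6 (n - 3 * j * (3 * j - 1) div 2) > 0"
    have "3 * j * (3 * j - 1) div 2 \<le> n"
      using j b6_neg[of "n - 3 * j * (3 * j - 1) div 2"] by linarith
    then have le: "3 * j * (3 * j - 1) \<le> 2 * n" using three_j_exact[of j] by linarith
    have a: "\<bar>j\<bar> \<le> j * j"
    proof (cases "j = 0")
      case False
      then have "\<bar>j\<bar> * 1 \<le> \<bar>j\<bar> * \<bar>j\<bar>" by (intro mult_left_mono) auto
      then show ?thesis by simp
    qed simp
    have "3 * j * (3 * j - 1) = 9 * (j * j) - 3 * j" by (simp add: algebra_simps)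
    with le a have "\<bar>j\<bar> \<le> \<bar>n\<bar>" by linarith
    then show "j \<in> {-\<bar>n\<bar>..\<bar>n\<bar>}" by auto
  qed
qed simp

end

theory Submission
  imports Defs "HOL-Library.Z2" "HOL-Computational_Algebra.Formal_Power_Series"
begin

text \<open>
  Write \<open>(S)\<close> for the product of \<open>1 - q ^ s\<close> over \<open>s \<in> S\<close>, let \<open>G = (3 \<nmid> s)\<close> and let \<open>B\<close> be its odd part
  \<open>(s \<equiv> \<plusminus>1 mod 6)\<close>. Modulo 2 the even part of \<open>G\<close> is \<open>G(q\<^sup>2) = G\<^sup>2\<close>, so that \<open>G = B G\<^sup>2\<close> and \<open>B G = 1\<close>.
  The generating function of \<open>b6\<close> is \<open>1 / ((s \<equiv> 3 mod 6) G)\<close>, and Jacobi's triple product turns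
  the sum of \<open>q ^ (3j(3j-1)/2)\<close> into \<open>(3 | s) = (6 | s) (s \<equiv> 3 mod 6)\<close>. Their product is
  \<open>(6 | s) / G = (6 | s) B\<close>, which by the triple product again is the sum of \<open>q ^ (k(3k-2))\<close>.
\<close>

unbundle fps_syntax

text \<open>Otherwise the binder of \<^const>\<open>Sum_any\<close> is ambiguous.\<close>

no_notation suminf (binder \<open>\<Sum>\<close> 10)

text \<open>These simp rules turn ring operations on \<open>bit\<close> into bitwise or Boolean
  ones, to which the ring lemmas no longer apply.\<close>

declare add_bit_eq_xor [simp del] mult_bit_eq_and [simp del] power_bit_unfold [simp del]

section \<open>Gaussian binomial coefficients\<close>

text \<open>The Gaussian binomial coefficient, given by its Pascal recurrence so that no division
  occurs and \<open>q\<close> may come from any commutative ring.\<close>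

fun qbinomial :: "'a::comm_ring_1 \<Rightarrow> nat \<Rightarrow> nat \<Rightarrow> 'a" where
  "qbinomial q n 0 = 1"
| "qbinomial q 0 (Suc k) = 0"
| "qbinomial q (Suc n) (Suc k) = qbinomial q n k + q ^ Suc k * qbinomial q n (Suc k)"

lemma qbinomial_eq_0: "n < k \<Longrightarrow> qbinomial q n k = 0"
  by (induction q n k rule: qbinomial.induct) auto

text \<open>Splitting off the factor \<open>k = 0\<close> leaves the same product with
  \<open>z * q\<close> for \<open>z\<close>; multiplying its expansion by \<open>y + z\<close> gives
  two sums that recombine by the Pascal recurrence. The second variable \<open>y\<close> makes the
  identity homogeneous.\<close>

theorem q_binomial_theorem:
  "(\<Prod>k<n. y + z * q ^ k) = (\<Sum>k\<le>n. qbinomial q n k * q ^ (k choose 2) * z ^ k * y ^ (n - k))"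
proof (induction n arbitrary: z)
  case (Suc n)
  define g where "g k = qbinomial q n k * q ^ (k choose 2) * (z * q) ^ k * y ^ (Suc n - k)" for k
  define h where "h k = qbinomial q n k * q ^ (Suc k choose 2) * z ^ Suc k * y ^ (n - k)" for k
  have choose: "Suc k choose 2 = (k choose 2) + k" for k
    by (simp add: numeral_2_eq_2)
  have "(\<Prod>k<Suc n. y + z * q ^ k) = (y + z) * (\<Prod>k<n. y + (z * q) * q ^ k)"
    by (simp add: prod.lessThan_Suc_shift mult.assoc del: prod.lessThan_Suc)
  also have "\<dots> = (\<Sum>k\<le>n. y * (qbinomial q n k * q ^ (k choose 2) * (z * q) ^ k * y ^ (n - k)))
                + (\<Sum>k\<le>n. z * (qbinomial q n k * q ^ (k choose 2) * (z * q) ^ k * y ^ (n - k)))"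
    by (simp add: Suc.IH distrib_right sum_distrib_left sum.distrib)
  also have "\<dots> = (\<Sum>k\<le>n. g k) + (\<Sum>k\<le>n. h k)"
    by (intro arg_cong2[of _ _ _ _ "(+)"] sum.cong refl)
      (auto simp: g_def h_def choose Suc_diff_le power_add power_mult_distrib mult_ac)
  also have "(\<Sum>k\<le>n. g k) = (\<Sum>k\<le>Suc n. g k)"
    by (simp add: g_def qbinomial_eq_0)
  also have "\<dots> = g 0 + (\<Sum>k\<le>n. g (Suc k))"
    by (rule sum.atMost_Suc_shift)
  also have "g 0 + (\<Sum>k\<le>n. g (Suc k)) + (\<Sum>k\<le>n. h k) = g 0 + (\<Sum>k\<le>n. g (Suc k) + h k)"
    by (simp add: sum.distrib)
  also have "\<dots> = (\<Sum>k\<le>Suc n. qbinomial q (Suc n) k * q ^ (k choose 2) * z ^ k * y ^ (Suc n - k))"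
    by (subst sum.atMost_Suc_shift)
      (auto simp: g_def h_def algebra_simps power_mult_distrib binomial_eq_0 intro!: sum.cong)
  finally show ?case .
qed (simp add: binomial_eq_0)

text \<open>The quotient formula for Gaussian binomials with denominators cleared. The inductive
  step joins the two Pascal terms through
  \<open>1 - q ^ (j + k) = (1 - q ^ j) + q ^ j * (1 - q ^ k)\<close>.\<close>

lemma qbinomial_mult:
  "qbinomial q (j + k) j * (\<Prod>i=1..j. 1 - q ^ i) * (\<Prod>i=1..k. 1 - q ^ i) = (\<Prod>i=1..j + k. 1 - q ^ i)"
proof (induction "j + k" arbitrary: j k)
  case (Suc n)
  let ?P = "\<lambda>n. \<Prod>i=1..n. 1 - q ^ i"
  show ?case
  proof (cases j)
    case j: (Suc j')
    show ?thesis
    proof (cases k)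
      case k: (Suc k')
      have IH1: "qbinomial q n j' * ?P j' * ?P k = ?P n"
        using Suc.hyps(1)[of j' k] Suc.hyps(2) j by simp
      have IH2: "qbinomial q n j * ?P j * ?P k' = ?P n"
        using Suc.hyps(1)[of j k'] Suc.hyps(2) k by simp
      have n: "Suc n = j + k" using Suc.hyps(2) by simp
      have "qbinomial q (j + k) j * ?P j * ?P k
          = (1 - q ^ j) * (qbinomial q n j' * ?P j' * ?P k)
            + q ^ j * (1 - q ^ k) * (qbinomial q n j * ?P j * ?P k')"
        unfolding n[symmetric] by (simp add: j k algebra_simps)
      also have "\<dots> = (1 - q ^ (j + k)) * ?P n"
        unfolding IH1 IH2 by (simp add: algebra_simps power_add)
      also have "\<dots> = ?P (j + k)"
        unfolding n[symmetric] by simp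
      finally show ?thesis .
    next
      case 0
      have "qbinomial q m m = 1" for m
        by (induction m) (auto simp: qbinomial_eq_0)
      then show ?thesis by (simp add: 0)
    qed
  qed simp
qed simp

section \<open>Truncated power series and infinite products\<close>

text \<open>Congruence modulo \<open>X ^ (N + 1)\<close>. Infinite products are compared by passing,
  for each \<open>N\<close>, to finite products congruent to them.\<close>

definition fps_eq_upto :: "nat \<Rightarrow> 'a fps \<Rightarrow> 'a fps \<Rightarrow> bool" where
  "fps_eq_upto N f g \<longleftrightarrow> (\<forall>k\<le>N. f $ k = g $ k)"

lemma fps_eq_upto_refl [simp]: "fps_eq_upto N f f"
  and fps_eq_upto_sym: "fps_eq_upto N f g \<Longrightarrow> fps_eq_upto N g f"
  and fps_eq_upto_trans: "fps_eq_upto N f g \<Longrightarrow> fps_eq_upto N g h \<Longrightarrow> fps_eq_upto N f h"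
  by (auto simp: fps_eq_upto_def)

lemma fps_eq_upto_mult:
  fixes f g :: "'a::comm_semiring_0 fps"
  shows "fps_eq_upto N f f' \<Longrightarrow> fps_eq_upto N g g' \<Longrightarrow> fps_eq_upto N (f * g) (f' * g')"
  by (auto simp: fps_eq_upto_def fps_mult_nth intro!: sum.cong)

lemma fps_eq_upto_cancel:
  fixes f g h :: "'a::field fps"
  assumes "fps_eq_upto N (f * h) (g * h)" "h $ 0 \<noteq> 0"
  shows "fps_eq_upto N f g"
proof -
  have "fps_eq_upto N (f * h * inverse h) (g * h * inverse h)"
    using assms(1) by (rule fps_eq_upto_mult) simp
  then show ?thesis
    using assms(2) by (simp add: mult.assoc inverse_mult_eq_1')
qed

lemma fps_eqI_upto: "(\<And>N. fps_eq_upto N f g) \<Longrightarrow> f = g"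
  by (auto simp: fps_eq_upto_def fps_eq_iff)

lemma fps_eq_upto_one_plus_X_power:
  "N < s \<Longrightarrow> fps_eq_upto N (1 + fps_X ^ s) (1 :: 'a::comm_semiring_1 fps)"
  by (auto simp: fps_eq_upto_def)

text \<open>The factor of index \<open>0\<close> is left out, so that the product always converges formally.\<close>

definition fps_qprod :: "nat set \<Rightarrow> 'a::comm_semiring_1 fps" where
  "fps_qprod S = Abs_fps (\<lambda>n. (\<Prod>s \<in> S \<inter> {1..n}. 1 + fps_X ^ s) $ n)"

lemma fps_eq_upto_prod:
  assumes "finite T" "R \<subseteq> T" "\<And>s. s \<in> T - R \<Longrightarrow> N < s"
  shows "fps_eq_upto N (\<Prod>s\<in>T. 1 + fps_X ^ s) (\<Prod>s\<in>R. 1 + fps_X ^ s :: 'a::comm_semiring_1 fps)"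
proof -
  have "fps_eq_upto N (\<Prod>s\<in>U. 1 + fps_X ^ s) (1 :: 'a fps)" if "finite U" "\<And>s. s \<in> U \<Longrightarrow> N < s" for U
    using that
  proof (induction U rule: finite_induct)
    case (insert s U)
    then have "fps_eq_upto N ((1 + fps_X ^ s) * (\<Prod>s\<in>U. 1 + fps_X ^ s)) (1 * 1 :: 'a fps)"
      by (intro fps_eq_upto_mult fps_eq_upto_one_plus_X_power) auto
    with insert show ?case by simp
  qed simp
  then have "fps_eq_upto N ((\<Prod>s\<in>T - R. 1 + fps_X ^ s) * (\<Prod>s\<in>R. 1 + fps_X ^ s))
               (1 * (\<Prod>s\<in>R. 1 + fps_X ^ s) :: 'a fps)"
    using assms by (intro fps_eq_upto_mult) auto
  then show ?thesis
    using assms by (simp add: prod.subset_diff[of R T])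
qed

text \<open>Factors of index above \<open>N\<close> are 1 modulo \<open>X ^ (N + 1)\<close>, so
  every finite part of \<open>S\<close> that contains its positive elements up to \<open>N\<close>
  serves. This freedom allows index sets such as the first \<open>m\<close> members of a residue
  class.\<close>

lemma fps_qprod_upto:
  assumes "finite T" "S \<inter> {1..N} \<subseteq> T" "T \<subseteq> S" "0 \<notin> T"
  shows "fps_eq_upto N (fps_qprod S) (\<Prod>s\<in>T. 1 + fps_X ^ s)"
  unfolding fps_eq_upto_def
proof (intro allI impI)
  fix k assume k: "k \<le> N"
  have T: "s > 0" if "s \<in> T" for s
    using that assms(4) by (cases s) auto
  have "fps_eq_upto k (\<Prod>s\<in>T. 1 + fps_X ^ s) (\<Prod>s\<in>S \<inter> {1..k}. 1 + fps_X ^ s :: 'a fps)"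
    using assms k T by (intro fps_eq_upto_prod) (auto simp: Suc_le_eq)
  then show "fps_qprod S $ k = (\<Prod>s\<in>T. 1 + fps_X ^ s :: 'a fps) $ k"
    by (simp add: fps_eq_upto_def fps_qprod_def)
qed

lemma fps_qprod_nth_0 [simp]: "fps_qprod S $ 0 = 1"
  by (simp add: fps_qprod_def)

lemma fps_qprod_Un_disjoint:
  assumes "S \<inter> T = {}"
  shows "fps_qprod (S \<union> T) = fps_qprod S * (fps_qprod T :: 'a::comm_semiring_1 fps)"
proof (rule fps_eqI_upto)
  fix N
  let ?P = "\<lambda>U. \<Prod>s \<in> U \<inter> {1..N}. 1 + fps_X ^ s :: 'a fps"
  have "fps_eq_upto N (fps_qprod S * fps_qprod T) (?P S * ?P T)"
    by (intro fps_eq_upto_mult fps_qprod_upto) auto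
  moreover have "?P S * ?P T = ?P (S \<union> T)"
    using assms by (subst prod.union_disjoint[symmetric]) (auto simp: Int_Un_distrib2)
  moreover have "fps_eq_upto N (fps_qprod (S \<union> T)) (?P (S \<union> T))"
    by (intro fps_qprod_upto) auto
  ultimately show "fps_eq_upto N (fps_qprod (S \<union> T)) (fps_qprod S * (fps_qprod T :: 'a fps))"
    by (metis fps_eq_upto_sym fps_eq_upto_trans)
qed

lemma bit_fps_double [simp]: "f + f = 0" for f :: "bit fps"
proof (rule fps_ext)
  show "(f + f) $ n = 0 $ n" for n
    by (cases "f $ n") (simp_all only: fps_add_nth, simp_all)
qed

text \<open>Identifies the classical factors \<open>1 - X ^ s\<close> with the factors
  \<open>1 + X ^ s\<close> of \<open>fps_qprod\<close>.\<close>

lemma bit_fps_diff: "f - g = f + g" for f g :: "bit fps"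
  using bit_fps_double[of g] by (simp only: diff_conv_add_uminus eq_neg_iff_add_eq_0[symmetric])

lemma bit_fps_one_plus_square: "(1 + f)\<^sup>2 = 1 + f\<^sup>2" for f :: "bit fps"
proof -
  have "(1 + f)\<^sup>2 = 1 + f\<^sup>2 + (f + f)"
    unfolding power2_sum mult_2 by (simp only: power_one mult_1_left mult_1_right distrib_right add_ac)
  then show ?thesis by (simp only: bit_fps_double add_0_right)
qed

text \<open>Squaring is additive in characteristic 2, so it takes each factor
  \<open>1 + X ^ s\<close> to \<open>1 + X ^ (2 * s)\<close>.\<close>

lemma fps_qprod_square: "(fps_qprod S)\<^sup>2 = (fps_qprod ((*) 2 ` S) :: bit fps)"
proof (rule fps_eqI_upto)
  fix N
  let ?T = "S \<inter> {1..N}"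
  have "fps_eq_upto N ((fps_qprod S)\<^sup>2) ((\<Prod>s\<in>?T. 1 + fps_X ^ s)\<^sup>2 :: bit fps)"
    unfolding power2_eq_square by (intro fps_eq_upto_mult fps_qprod_upto) auto
  also have "(\<Prod>s\<in>?T. 1 + fps_X ^ s)\<^sup>2 = (\<Prod>s\<in>?T. 1 + fps_X ^ (2 * s) :: bit fps)"
    unfolding prod_power_distrib
    by (intro prod.cong refl) (simp only: bit_fps_one_plus_square power_even_eq)
  also have "\<dots> = (\<Prod>s\<in>(*) 2 ` ?T. 1 + fps_X ^ s)"
    by (subst prod.reindex) (auto simp: inj_on_def)
  finally have 1: "fps_eq_upto N ((fps_qprod S)\<^sup>2) (\<Prod>s\<in>(*) 2 ` ?T. 1 + fps_X ^ s :: bit fps)" .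
  have "fps_eq_upto N (fps_qprod ((*) 2 ` S)) (\<Prod>s\<in>(*) 2 ` ?T. 1 + fps_X ^ s :: bit fps)"
    by (intro fps_qprod_upto) auto
  with 1 show "fps_eq_upto N ((fps_qprod S)\<^sup>2) (fps_qprod ((*) 2 ` S) :: bit fps)"
    by (metis fps_eq_upto_sym fps_eq_upto_trans)
qed

section \<open>Jacobi's triple product modulo 2\<close>

lemma choose_2_twice: "2 * int (n choose 2) = int n * (int n - 1)"
  by (induction n) (auto simp: numeral_2_eq_2 algebra_simps)

text \<open>Nonnegative for \<open>0 < a < M\<close>, so that \<open>nat\<close> does not truncate.\<close>

definition theta_exponent :: "nat \<Rightarrow> nat \<Rightarrow> int \<Rightarrow> nat" where
  "theta_exponent M a i = nat (int M * (i * (i - 1) div 2) + int a * i)"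

lemma triangular_twice: "2 * (i * (i - 1) div 2) = i * (i - 1)" for i :: int
  by (rule dvd_mult_div_cancel) simp

text \<open>With \<open>t\<close> the triangular term, \<open>t \<ge> 0\<close> and
  \<open>a \<ge> 1\<close> settle \<open>i \<ge> 0\<close>. For negative \<open>i\<close> one has
  \<open>t \<ge> - i\<close>, so the value is at least \<open>(M - a) * (- i) \<ge> - i\<close>. The
  linear bound leaves only indices with \<open>\<bar>i\<bar> \<le> n\<close> at order
  \<open>n\<close>.\<close>

lemma
  assumes "0 < a" "a < M"
  shows abs_le_theta_exponent: "\<bar>i\<bar> \<le> int (theta_exponent M a i)"
    and theta_exponent_int: "int (theta_exponent M a i) = int M * (i * (i - 1) div 2) + int a * i"
proof -
  define t where "t = i * (i - 1) div 2"
  have t: "2 * t = i * (i - 1)"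
    unfolding t_def by (rule triangular_twice)
  have "0 \<le> t"
  proof (cases "i \<ge> 1")
    case False
    then have "0 \<le> (- i) * (1 - i)" by (intro mult_nonneg_nonneg) auto
    with t show ?thesis by (simp add: algebra_simps)
  qed (use t in \<open>auto simp: zero_le_mult_iff intro!: mult_left_le_imp_le[of 2 0 t]\<close>)
  have "\<bar>i\<bar> \<le> int M * t + int a * i"
  proof (cases "i \<ge> 0")
    case True
    then have "i * 1 \<le> i * int a"
      using assms by (intro mult_left_mono) auto
    moreover have "0 \<le> int M * t"
      using \<open>0 \<le> t\<close> by simp
    ultimately show ?thesis using True by (simp add: mult.commute)
  next
    case False
    have "(- i) * 2 \<le> (- i) * (1 - i)"
      using False by (intro mult_left_mono) auto
    then have "- i \<le> t" using t by (simp add: algebra_simps)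
    then have "int M * (- i) \<le> int M * t"
      by (intro mult_left_mono) auto
    moreover have "(- i) * 1 \<le> (- i) * (int M - int a)"
      using False assms by (intro mult_left_mono) auto
    ultimately show ?thesis using False by (simp add: algebra_simps)
  qed
  then show "\<bar>i\<bar> \<le> int (theta_exponent M a i)"
    and "int (theta_exponent M a i) = int M * (i * (i - 1) div 2) + int a * i"
    by (auto simp: theta_exponent_def t_def)
qed

lemma prod_fps_X_power_arith:
  "(\<Prod>k<m. fps_X ^ (a + M * k) :: 'a::comm_semiring_1 fps) = fps_X ^ (a * m + M * (m choose 2))"
  by (induction m) (auto simp: numeral_2_eq_2 algebra_simps simp flip: power_add)

lemma prod_lessThan_add:
  "(\<Prod>k<m + n. f k) = (\<Prod>k<m. f k) * (\<Prod>k<n. f (m + k) :: 'a::comm_monoid_mult)" for m n :: nat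
  by (induction n) (simp_all add: mult.assoc)

text \<open>The q-binomial theorem with \<open>2 * m\<close> factors and base \<open>X ^ M\<close>:
  pulling a monomial out of each factor turns the first \<open>m\<close> of them into one product on
  the left (in reverse order) and the last \<open>m\<close> into the other. The common monomial is
  finally cancelled in the integral domain.\<close>

theorem finite_jacobi_triple_product:
  fixes a M m :: nat
  assumes "0 < a" "a < M"
  shows "(\<Prod>k<m. 1 + fps_X ^ (M * Suc k - a)) * (\<Prod>k<m. 1 + fps_X ^ (M * k + a))
    = (\<Sum>j\<le>2 * m. qbinomial (fps_X ^ M) (2 * m) j * fps_X ^ theta_exponent M a (int j - int m) :: 'a::idom fps)"
    (is "?lhs = ?rhs")
proof -
  \<comment> \<open>\<open>E\<close> is the total exponent pulled out: the first two summands come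
    from the lower \<open>m\<close> factors, the last from the upper \<open>m\<close>.\<close>
  define E where "E = a * m + M * (m choose 2) + M * m * m"
  let ?f = "\<lambda>k. fps_X ^ (M * m) + fps_X ^ a * (fps_X ^ M) ^ k :: 'a fps"
  \<comment> \<open>The q-binomial theorem at \<open>z = q ^ (a - M m)\<close>, homogenised so that no negative exponent occurs.\<close>
  have "(\<Prod>k<2 * m. ?f k) = (\<Prod>k<m. ?f k) * (\<Prod>k<m. ?f (m + k))"
    unfolding mult_2 by (rule prod_lessThan_add)
  also have "(\<Prod>k<m. ?f k) = (\<Prod>k<m. fps_X ^ (a + M * k) * (1 + fps_X ^ (M * (m - k) - a)))"
  proof (intro prod.cong refl)
    fix k assume "k \<in> {..<m}"
    then obtain d where "m = k + Suc d"
      using less_imp_Suc_add by auto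
    then have "M * m = a + M * k + (M * (m - k) - a)"
      using assms by (simp add: algebra_simps)
    then have "fps_X ^ (M * m) = fps_X ^ (a + M * k) * (fps_X ^ (M * (m - k) - a) :: 'a fps)"
      by (metis power_add)
    then show "?f k = fps_X ^ (a + M * k) * (1 + fps_X ^ (M * (m - k) - a))"
      by (simp add: algebra_simps power_add power_mult)
  qed
  also have "\<dots> = fps_X ^ (a * m + M * (m choose 2)) * (\<Prod>k<m. 1 + fps_X ^ (M * (m - k) - a))"
    by (simp add: prod.distrib prod_fps_X_power_arith)
  also have "(\<Prod>k<m. 1 + fps_X ^ (M * (m - k) - a) :: 'a fps) = (\<Prod>k<m. 1 + fps_X ^ (M * Suc k - a))"
    by (subst prod.nat_diff_reindex[symmetric]) (auto intro!: prod.cong)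
  also have "(\<Prod>k<m. ?f (m + k)) = (\<Prod>k<m. fps_X ^ (M * m) * (1 + fps_X ^ (M * k + a)))"
    by (intro prod.cong refl) (simp add: distrib_left power_add mult_ac flip: power_mult)
  also have "\<dots> = fps_X ^ (M * m * m) * (\<Prod>k<m. 1 + fps_X ^ (M * k + a))"
    by (simp add: prod.distrib power_mult)
  finally have lhs: "(\<Prod>k<2 * m. ?f k) = fps_X ^ E * ?lhs"
    by (simp add: E_def power_add mult_ac)
  have "(\<Prod>k<2 * m. ?f k)
      = (\<Sum>j\<le>2 * m. qbinomial (fps_X ^ M) (2 * m) j * (fps_X ^ M) ^ (j choose 2)
            * (fps_X ^ a) ^ j * (fps_X ^ (M * m)) ^ (2 * m - j))"
    by (rule q_binomial_theorem)
  also have "\<dots> = fps_X ^ E * ?rhs"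
    unfolding sum_distrib_left
  proof (intro sum.cong refl)
    fix j assume j: "j \<in> {..2 * m}"
    define d where "d = (int j - int m) * (int j - int m - 1) div 2"
    have "2 * d = (int j - int m) * (int j - int m - 1)"
      unfolding d_def by (rule triangular_twice)
    \<comment> \<open>Substituting \<open>j = m + (j - m)\<close> recentres the quadratic exponent
      at \<open>m\<close>; the terms linear in \<open>j - m\<close> with coefficient
      \<open>m\<close> cancel. Doubling clears the halves.\<close>
    then have "2 * (int (j choose 2) + int m * (2 * int m - int j)) = 2 * (int (m choose 2) + int m * int m + d)"
      using choose_2_twice[of j] choose_2_twice[of m] by (simp add: algebra_simps)
    then have *: "int (j choose 2) + int m * (2 * int m - int j) = int (m choose 2) + int m * int m + d"
      by simp
    have "int (M * (j choose 2) + a * j + M * m * (2 * m - j))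
        = int M * (int (j choose 2) + int m * (2 * int m - int j)) + int a * int j"
      using j by (simp only: of_nat_add of_nat_mult) (simp add: of_nat_diff distrib_left mult_ac add_ac)
    also have "\<dots> = int E + (int M * d + int a * (int j - int m))"
      unfolding * E_def by (simp add: algebra_simps)
    also have "\<dots> = int (E + theta_exponent M a (int j - int m))"
      by (simp add: theta_exponent_int[OF assms] d_def)
    finally have "M * (j choose 2) + a * j + M * m * (2 * m - j) = E + theta_exponent M a (int j - int m)"
      by (simp only: of_nat_eq_iff)
    then have "fps_X ^ (M * (j choose 2) + a * j + M * m * (2 * m - j))
        = (fps_X ^ (E + theta_exponent M a (int j - int m)) :: 'a fps)"
      by (simp only:)
    then have "fps_X ^ E * fps_X ^ theta_exponent M a (int j - int m)
        = (fps_X ^ M) ^ (j choose 2) * (fps_X ^ a) ^ j * (fps_X ^ (M * m) :: 'a fps) ^ (2 * m - j)"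
      by (simp only: power_add flip: power_mult)
    then show "qbinomial (fps_X ^ M) (2 * m) j * (fps_X ^ M) ^ (j choose 2) * (fps_X ^ a) ^ j
          * (fps_X ^ (M * m)) ^ (2 * m - j)
        = fps_X ^ E * (qbinomial (fps_X ^ M) (2 * m) j * fps_X ^ theta_exponent M a (int j - int m) :: 'a fps)"
      by (simp only: mult.assoc mult.left_commute[of "fps_X ^ E"])
  qed
  finally show ?thesis
    using lhs by simp
qed

text \<open>By \<open>qbinomial_mult\<close> the Gaussian binomial times two finite products is a
  third one. Each of the three agrees with \<open>?A\<close> up to order \<open>N\<close>, so one
  copy of \<open>?A\<close>, of constant term 1, cancels.\<close>

lemma qbinomial_limit:
  assumes "0 < M" "N \<le> j" "N \<le> k"
  shows "fps_eq_upto N (fps_qprod {s. M dvd s} * qbinomial (fps_X ^ M) (j + k) j) (1 :: bit fps)"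
proof -
  let ?A = "fps_qprod {s. M dvd s} :: bit fps"
  have A: "fps_eq_upto N ?A (\<Prod>i=1..n. 1 - (fps_X ^ M) ^ i)" if "N \<le> n" for n
  proof -
    have "(\<Prod>i=1..n. 1 - (fps_X ^ M) ^ i) = (\<Prod>s\<in>(*) M ` {1..n}. 1 + fps_X ^ s :: bit fps)"
      using assms(1) by (subst prod.reindex) (auto simp: inj_on_def bit_fps_diff power_mult)
    moreover have sub: "{s. M dvd s} \<inter> {1..N} \<subseteq> (*) M ` {1..n}"
    proof
      fix s assume s: "s \<in> {s. M dvd s} \<inter> {1..N}"
      then obtain t where t: "s = M * t" by blast
      have "1 * t \<le> M * t" using assms(1) by (intro mult_right_mono) auto
      with s t that have "t \<in> {1..n}" by (cases t) auto
      with t show "s \<in> (*) M ` {1..n}" by blast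
    qed
    have "fps_eq_upto N ?A (\<Prod>s\<in>(*) M ` {1..n}. 1 + fps_X ^ s)"
      by (rule fps_qprod_upto[OF _ sub]) (use assms(1) in auto)
    ultimately show ?thesis
      by (simp only:)
  qed
  let ?q = "qbinomial (fps_X ^ M) (j + k) j :: bit fps"
  have "fps_eq_upto N (?q * ?A * ?A) (?q * (\<Prod>i=1..j. 1 - (fps_X ^ M) ^ i) * (\<Prod>i=1..k. 1 - (fps_X ^ M) ^ i))"
    using assms by (intro fps_eq_upto_mult A fps_eq_upto_refl)
  also have "\<dots> = (\<Prod>i=1..j + k. 1 - (fps_X ^ M) ^ i)"
    by (rule qbinomial_mult)
  finally have "fps_eq_upto N ((?A * ?q) * ?A) (1 * ?A)"
    using A[of "j + k"] assms by (auto simp: mult_ac intro: fps_eq_upto_sym fps_eq_upto_trans)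
  then show ?thesis
    by (rule fps_eq_upto_cancel) simp
qed

text \<open>The sum of \<open>X ^ theta_exponent M a i\<close> over all integers \<open>i\<close>,
  collected by exponent. For \<open>0 < a < M\<close> every set counted here is finite.\<close>

definition theta_series :: "nat \<Rightarrow> nat \<Rightarrow> 'a::comm_semiring_1 fps" where
  "theta_series M a = Abs_fps (\<lambda>n. of_nat (card {i. theta_exponent M a i = n}))"

lemma finite_theta_exponent_le:
  assumes "0 < a" "a < M"
  shows "finite {i. theta_exponent M a i \<le> n}"
proof (rule finite_subset)
  show "{i. theta_exponent M a i \<le> n} \<subseteq> {- int n..int n}"
  proof
    fix i assume "i \<in> {i. theta_exponent M a i \<le> n}"
    then show "i \<in> {- int n..int n}"
      using abs_le_theta_exponent[OF assms, of i] by auto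
  qed
qed simp

lemma fps_qprod_residue_class_upto:
  assumes "0 < c" "c < M" "N < m"
  shows "fps_eq_upto N (fps_qprod {s. s mod M = c}) (\<Prod>k<m. 1 + fps_X ^ (M * k + c) :: 'a::comm_semiring_1 fps)"
proof -
  have "(\<Prod>k<m. 1 + fps_X ^ (M * k + c)) = (\<Prod>s\<in>(\<lambda>k. M * k + c) ` {..<m}. 1 + fps_X ^ s :: 'a fps)"
    using assms by (subst prod.reindex) (auto simp: inj_on_def)
  moreover have "{s. s mod M = c} \<inter> {1..N} \<subseteq> (\<lambda>k. M * k + c) ` {..<m}"
  proof
    fix s assume s: "s \<in> {s. s mod M = c} \<inter> {1..N}"
    then have "s = M * (s div M) + c" by auto
    moreover have "s div M < m"
      using s assms by (intro le_less_trans[OF div_le_dividend]) auto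
    ultimately show "s \<in> (\<lambda>k. M * k + c) ` {..<m}" by blast
  qed
  ultimately show ?thesis
    using assms by (auto intro!: fps_qprod_upto)
qed

text \<open>The finite identity is multiplied by the product over the multiples of \<open>M\<close>
  and read at order \<open>n\<close> for large \<open>m\<close>; there each surviving Gaussian
  binomial becomes 1 by \<open>qbinomial_limit\<close>.\<close>

theorem jacobi_triple_product_mod_2:
  assumes "0 < a" "a < M"
  shows "fps_qprod {s. M dvd s} * fps_qprod {s. s mod M = M - a} * fps_qprod {s. s mod M = a}
    = (theta_series M a :: bit fps)"
proof (rule fps_ext)
  fix n
  \<comment> \<open>Large enough that \<open>\<bar>j - m\<bar> \<le> n\<close> forces both
    \<open>n \<le> j\<close> and \<open>n \<le> 2 * m - j\<close>, and that \<open>m\<close> factors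
    of each residue class suffice at order \<open>n\<close>.\<close>
  define m :: nat where "m = 2 * n + 1"
  let ?A = "fps_qprod {s. M dvd s} :: bit fps"
  let ?q = "\<lambda>j. qbinomial (fps_X ^ M) (2 * m) j :: bit fps"
  let ?e = "\<lambda>j. theta_exponent M a (int j - int m)"
  have "fps_eq_upto n (?A * fps_qprod {s. s mod M = M - a} * fps_qprod {s. s mod M = a})
      (?A * (\<Prod>k<m. 1 + fps_X ^ (M * k + (M - a))) * (\<Prod>k<m. 1 + fps_X ^ (M * k + a)))"
    using assms by (intro fps_eq_upto_mult fps_eq_upto_refl fps_qprod_residue_class_upto) (auto simp: m_def)
  also have "(\<Prod>k<m. 1 + fps_X ^ (M * k + (M - a)) :: bit fps) = (\<Prod>k<m. 1 + fps_X ^ (M * Suc k - a))"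
    using assms by (intro prod.cong refl) simp
  also have "?A * \<dots> * (\<Prod>k<m. 1 + fps_X ^ (M * k + a)) = (\<Sum>j\<le>2 * m. (?A * ?q j) * fps_X ^ ?e j)"
    unfolding mult.assoc finite_jacobi_triple_product[OF assms] sum_distrib_left ..
  finally have "(?A * fps_qprod {s. s mod M = M - a} * fps_qprod {s. s mod M = a}) $ n
      = (\<Sum>j\<le>2 * m. ((?A * ?q j) * fps_X ^ ?e j) $ n)"
    by (simp add: fps_eq_upto_def fps_sum_nth)
  also have "\<dots> = (\<Sum>j\<le>2 * m. if ?e j = n then 1 else 0)"
  proof (intro sum.cong refl)
    fix j assume j: "j \<in> {..2 * m}"
    show "((?A * ?q j) * fps_X ^ ?e j) $ n = (if ?e j = n then 1 else 0)"
    proof (cases "?e j \<le> n")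
      case True
      then have "\<bar>int j - int m\<bar> \<le> int n"
        using abs_le_theta_exponent[OF assms, of "int j - int m"] by linarith
      then have "n \<le> j" "n \<le> 2 * m - j" by (auto simp: m_def)
      then have "fps_eq_upto n (?A * ?q j) 1"
        using qbinomial_limit[of M n j "2 * m - j"] assms j by simp
      with True show ?thesis
        by (simp add: fps_eq_upto_def fps_X_power_mult_right_nth)
    qed (simp add: fps_X_power_mult_right_nth)
  qed
  also have "\<dots> = of_nat (card {j \<in> {..2 * m}. ?e j = n})"
    by (simp add: sum.If_cases Int_def)
  also have "card {j \<in> {..2 * m}. ?e j = n} = card {i. theta_exponent M a i = n}"
  proof (rule bij_betw_same_card, rule bij_betw_imageI)
    show "inj_on (\<lambda>j. int j - int m) {j \<in> {..2 * m}. ?e j = n}"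
      by (auto simp: inj_on_def)
    show "(\<lambda>j. int j - int m) ` {j \<in> {..2 * m}. ?e j = n} = {i. theta_exponent M a i = n}"
    proof (intro equalityI subsetI)
      fix i assume i: "i \<in> {i. theta_exponent M a i = n}"
      then have "\<bar>i\<bar> \<le> int n"
        using abs_le_theta_exponent[OF assms, of i] by auto
      then have "i = int (nat (i + int m)) - int m" "nat (i + int m) \<le> 2 * m"
        by (auto simp: m_def)
      with i show "i \<in> (\<lambda>j. int j - int m) ` {j \<in> {..2 * m}. ?e j = n}"
        by (intro image_eqI[of _ _ "nat (i + int m)"]) auto
    qed auto
  qed
  finally show "(?A * fps_qprod {s. s mod M = M - a} * fps_qprod {s. s mod M = a}) $ n = theta_series M a $ n"
    by (simp add: theta_series_def)
qed

section \<open>Generating functions of partitions\<close>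

definition partitions_into :: "nat set \<Rightarrow> nat \<Rightarrow> nat multiset set" where
  "partitions_into S n = {P. set_mset P \<subseteq> S \<and> \<Sum>\<^sub># P = n}"

lemma finite_partitions_into: "0 \<notin> S \<Longrightarrow> finite (partitions_into S n)"
  by (rule finite_subset[OF _ finite_partitions[of n]])
    (auto simp: partitions_into_def partitions_def intro: gr0I)

definition partition_series :: "nat set \<Rightarrow> 'a::comm_semiring_1 fps" where
  "partition_series S = Abs_fps (\<lambda>n. of_nat (card (partitions_into S n)))"

lemma partitions_into_insert:
  assumes "s \<notin> S"
  shows "partitions_into (insert s S) n
    = partitions_into S n \<union> (if s \<le> n then add_mset s ` partitions_into (insert s S) (n - s) else {})"
    (is "?L = ?R")
proof (intro equalityI subsetI)
  fix P assume P: "P \<in> ?L"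
  show "P \<in> ?R"
  proof (cases "s \<in># P")
    case True
    then obtain Q where "P = add_mset s Q" by (metis multi_member_split)
    with P show ?thesis by (auto simp: partitions_into_def)
  qed (use P in \<open>auto simp: partitions_into_def\<close>)
qed (auto simp: partitions_into_def split: if_splits)

text \<open>A partition either avoids \<open>s\<close> or arises uniquely by adding one copy of
  \<open>s\<close> to a partition of \<open>n - s\<close> that may itself contain
  \<open>s\<close>.\<close>

lemma partition_series_insert:
  assumes "s \<notin> S" "0 \<notin> insert s S"
  shows "partition_series (insert s S) * (1 - fps_X ^ s) = (partition_series S :: 'a::comm_ring_1 fps)"
proof (rule fps_ext)
  fix n
  have "card (partitions_into (insert s S) n)
      = card (partitions_into S n) + (if s \<le> n then card (partitions_into (insert s S) (n - s)) else 0)"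
  proof (cases "s \<le> n")
    case True
    have "s \<notin># P" if "P \<in> partitions_into S n" for P
      using that assms(1) unfolding partitions_into_def by blast
    then have "partitions_into S n \<inter> add_mset s ` partitions_into (insert s S) (n - s) = {}"
      by fastforce
    moreover have "card (add_mset s ` partitions_into (insert s S) (n - s)) = card (partitions_into (insert s S) (n - s))"
      by (rule card_image) (simp add: inj_on_def)
    moreover have "partitions_into (insert s S) n
        = partitions_into S n \<union> add_mset s ` partitions_into (insert s S) (n - s)"
      using assms(1) True by (subst partitions_into_insert) simp_all
    ultimately show ?thesis
      using assms True by (simp add: card_Un_disjoint finite_partitions_into)
  next
    case False
    then show ?thesis
      using assms by (subst partitions_into_insert) auto
  qed
  then show "(partition_series (insert s S) * (1 - fps_X ^ s)) $ n = (partition_series S :: 'a fps) $ n"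
    by (simp add: partition_series_def right_diff_distrib fps_X_power_mult_right_nth)
qed

lemma partition_series_mult_prod:
  assumes "finite S" "0 \<notin> S"
  shows "partition_series S * (\<Prod>s\<in>S. 1 - fps_X ^ s) = (1 :: 'a::comm_ring_1 fps)"
  using assms
proof (induction S rule: finite_induct)
  case empty
  have "partitions_into {} n = (if n = 0 then {{#}} else {})" for n
    by (auto simp: partitions_into_def)
  then show ?case by (auto simp: partition_series_def fps_eq_iff)
next
  case (insert s S)
  then have "partition_series (insert s S) * (1 - fps_X ^ s) = (partition_series S :: 'a fps)"
    by (intro partition_series_insert) auto
  with insert show ?case
    by (simp add: mult.assoc[symmetric])
qed

text \<open>Euler's product formula. Partitions of \<open>n \<le> N\<close> have all parts in
  \<open>{1..N}\<close>, which reduces the claim at order \<open>N\<close> to a finite set of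
  parts.\<close>

lemma partition_series_mult_fps_qprod:
  assumes "0 \<notin> S"
  shows "partition_series S * fps_qprod S = (1 :: bit fps)"
proof (rule fps_eqI_upto)
  fix N
  let ?T = "S \<inter> {1..N}"
  have "partitions_into S n = partitions_into ?T n" if "n \<le> N" for n
  proof -
    have "p \<in> {1..N}" if "p \<in># P" "P \<in> partitions_into S n" for p P
    proof -
      have "p \<noteq> 0"
        using that assms by (metis (mono_tags, lifting) mem_Collect_eq partitions_into_def subsetD)
      moreover have "p \<le> \<Sum>\<^sub># P"
        using that(1) by (auto dest!: multi_member_split)
      ultimately show ?thesis
        using that \<open>n \<le> N\<close> by (auto simp: partitions_into_def)
    qed
    then show ?thesis
      by (auto simp: partitions_into_def)
  qed
  then have "fps_eq_upto N (partition_series S) (partition_series ?T :: bit fps)"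
    by (simp add: fps_eq_upto_def partition_series_def)
  then have "fps_eq_upto N (partition_series S * fps_qprod S)
      (partition_series ?T * (\<Prod>s\<in>?T. 1 + fps_X ^ s) :: bit fps)"
    by (intro fps_eq_upto_mult fps_qprod_upto) auto
  also have "partition_series ?T * (\<Prod>s\<in>?T. 1 + fps_X ^ s) = (1 :: bit fps)"
    using partition_series_mult_prod[of ?T, where 'a = bit] assms by (simp add: bit_fps_diff)
  finally show "fps_eq_upto N (partition_series S * fps_qprod S) (1 :: bit fps)" .
qed

text \<open>Since 6 divides 0, the condition \<open>\<not> 6 dvd s\<close> already forces the parts
  to be positive.\<close>

lemma b6_eq: "b6 (int n) = card (partitions_into {s. \<not> 6 dvd s} n)"
proof -
  have "{P \<in> partitions n. regular_partition 6 P} = partitions_into {s. \<not> 6 dvd s} n"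
    by (auto simp: partitions_def partitions_into_def regular_partition_def intro: gr0I)
  then show ?thesis by (simp add: b6_def)
qed

section \<open>The product identity for 6-regular partitions\<close>

text \<open>The even indices prime to 3 are the doubles of all indices prime to 3, so
  \<open>fps_qprod_square\<close> gives \<open>?G = ?B * ?G\<^sup>2\<close>, and one factor
  \<open>?G\<close> cancels.\<close>

lemma fps_qprod_3_regular:
  "fps_qprod {s. odd s \<and> \<not> 3 dvd s} * fps_qprod {s. \<not> 3 dvd s} = (1 :: bit fps)"
proof -
  let ?G = "fps_qprod {s. \<not> 3 dvd s} :: bit fps"
  let ?B = "fps_qprod {s. odd s \<and> \<not> 3 dvd s} :: bit fps"
  have "{s::nat. \<not> 3 dvd s} = {s. odd s \<and> \<not> 3 dvd s} \<union> (*) 2 ` {s. \<not> 3 dvd s}"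
  proof (intro equalityI subsetI)
    fix s :: nat assume s: "s \<in> {s. \<not> 3 dvd s}"
    show "s \<in> {s. odd s \<and> \<not> 3 dvd s} \<union> (*) 2 ` {s. \<not> 3 dvd s}"
    proof (cases "even s")
      case True
      then obtain t where "s = 2 * t" by blast
      with s show ?thesis by (auto simp: dvd_mult)
    qed (use s in simp)
  next
    fix s :: nat assume "s \<in> {s. odd s \<and> \<not> 3 dvd s} \<union> (*) 2 ` {s. \<not> 3 dvd s}"
    moreover have "\<not> 3 dvd 2 * t" if "\<not> 3 dvd t" for t :: nat
      using that by presburger
    ultimately show "s \<in> {s. \<not> 3 dvd s}" by auto
  qed
  then have "?G = fps_qprod ({s. odd s \<and> \<not> 3 dvd s} \<union> (*) 2 ` {s. \<not> 3 dvd s})"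
    by (rule arg_cong)
  also have "\<dots> = ?B * ?G\<^sup>2"
    unfolding fps_qprod_square by (rule fps_qprod_Un_disjoint) auto
  finally have "(?B * ?G) * ?G = 1 * ?G"
    by (simp add: power2_eq_square mult.assoc)
  moreover have "?G \<noteq> 0"
    using fps_qprod_nth_0 by (metis fps_zero_nth zero_neq_one)
  ultimately show ?thesis
    by (simp only: mult_cancel_right simp_thms)
qed

theorem partition_series_6_regular_mult_theta:
  "partition_series {s. \<not> 6 dvd s} * theta_series 9 3 = (theta_series 6 1 :: bit fps)"
proof -
  let ?P = "fps_qprod :: nat set \<Rightarrow> bit fps"
  let ?R = "partition_series {s. \<not> 6 dvd s} :: bit fps"
  \<comment> \<open>The classes 0, 6 and 3 modulo 9 together are the multiples of 3, which are then
    split again modulo 6.\<close>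
  have "theta_series 9 3 = ?P ({s. 9 dvd s} \<union> {s. s mod 9 = 6} \<union> {s. s mod 9 = 3})"
    by (subst fps_qprod_Un_disjoint, force, subst fps_qprod_Un_disjoint, force)
      (simp flip: jacobi_triple_product_mod_2)
  also have "{s. 9 dvd s} \<union> {s. s mod 9 = 6} \<union> {s. s mod 9 = 3} = {s::nat. 3 dvd s}"
    by (intro set_eqI) (simp, presburger)
  also have "\<dots> = {s. 6 dvd s} \<union> {s. s mod 6 = 3}"
    by (intro set_eqI) (simp, presburger)
  also have "?P \<dots> = ?P {s. 6 dvd s} * ?P {s. s mod 6 = 3}"
    by (rule fps_qprod_Un_disjoint) auto
  finally have theta_9: "theta_series 9 3 = ?P {s. 6 dvd s} * ?P {s. s mod 6 = 3}" .
  have "theta_series 6 1 = ?P {s. 6 dvd s} * ?P ({s. s mod 6 = 5} \<union> {s. s mod 6 = 1})"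
    by (subst fps_qprod_Un_disjoint, force)
      (simp flip: jacobi_triple_product_mod_2 add: mult.assoc)
  also have "{s. s mod 6 = 5} \<union> {s. s mod 6 = 1} = {s::nat. odd s \<and> \<not> 3 dvd s}"
    by (intro set_eqI) (simp, presburger)
  finally have theta_6: "theta_series 6 1 = ?P {s. 6 dvd s} * ?P {s. odd s \<and> \<not> 3 dvd s}" .
  have "{s::nat. \<not> 6 dvd s} = {s. s mod 6 = 3} \<union> {s. \<not> 3 dvd s}"
    by (intro set_eqI) (simp, presburger)
  then have "?P {s. \<not> 6 dvd s} = ?P ({s. s mod 6 = 3} \<union> {s. \<not> 3 dvd s})"
    by (rule arg_cong)
  also have "\<dots> = ?P {s. s mod 6 = 3} * ?P {s. \<not> 3 dvd s}"
    by (rule fps_qprod_Un_disjoint) (auto, presburger)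
  finally have *: "?R * (?P {s. s mod 6 = 3} * ?P {s. \<not> 3 dvd s}) = 1"
    using partition_series_mult_fps_qprod[of "{s. \<not> 6 dvd s}"] by simp
  \<comment> \<open>A factor equal to 1 is inserted: its half over the indices prime to 3 completes
    the inverse of \<open>?R\<close>, and its odd half completes
    \<open>theta_series 6 1\<close>.\<close>
  have "?R * theta_series 9 3
      = ?R * (?P {s. 6 dvd s} * ?P {s. s mod 6 = 3}) * (?P {s. odd s \<and> \<not> 3 dvd s} * ?P {s. \<not> 3 dvd s})"
    unfolding theta_9 fps_qprod_3_regular by simp
  also have "\<dots> = theta_series 6 1 * (?R * (?P {s. s mod 6 = 3} * ?P {s. \<not> 3 dvd s}))"
    unfolding theta_6 by (simp only: mult_ac)
  finally show ?thesis
    unfolding * by simp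
qed

section \<open>Comparison of coefficients\<close>

lemma of_nat_bit: "(of_nat n :: bit) = 1 \<longleftrightarrow> odd n"
  by (metis bit_not_zero_iff even_of_nat even_zero odd_one)

lemma theta_exponent_9_3: "int (theta_exponent 9 3 j) = 3 * j * (3 * j - 1) div 2"
proof -
  have "2 * int (theta_exponent 9 3 j) = 9 * (2 * (j * (j - 1) div 2)) + 6 * j"
    by (simp add: theta_exponent_int)
  also have "\<dots> = 2 * (3 * j * (3 * j - 1) div 2)"
    unfolding three_j_exact triangular_twice by (simp add: algebra_simps)
  finally have "2 * int (theta_exponent 9 3 j) = 2 * (3 * j * (3 * j - 1) div 2)" .
  then show ?thesis by simp
qed

lemma theta_exponent_6_1: "int (theta_exponent 6 1 k) = k * (3 * k - 2)"
proof -
  have "int (theta_exponent 6 1 k) = 3 * (2 * (k * (k - 1) div 2)) + k"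
    by (simp add: theta_exponent_int)
  then show ?thesis
    unfolding triangular_twice by (simp add: algebra_simps)
qed

text \<open>The difference of the two sides is \<open>(i - k) * (3 * (i + k) - 2)\<close>, whose
  second factor is not divisible by 3 and hence nonzero. So the coefficients of
  \<open>theta_series 6 1\<close> count at most one \<open>k\<close>, and their parity decides
  whether one exists.\<close>

lemma octagonal_eq_iff: "i * (3 * i - 2) = k * (3 * k - 2) \<longleftrightarrow> i = k" for i k :: int
proof
  assume "i * (3 * i - 2) = k * (3 * k - 2)"
  then have "(i - k) * (3 * (i + k) - 2) = 0" by (simp add: algebra_simps)
  moreover have "3 * (i + k) - 2 \<noteq> 0" by presburger
  ultimately show "i = k" by simp
qed simp

theorem corollary1p11:
  fixes n :: int
  assumes "n \<ge> 0"
  shows "[(\<Sum>j::int. b6 (n - 3 * j * (3 * j - 1) div 2)) = 1] (mod 2) \<longleftrightarrow> generalized_octagonal n"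
proof -
  define N where "N = nat n"
  have n: "n = int N" using assms by (simp add: N_def)
  let ?e = "theta_exponent 9 3"
  let ?S = "\<Sum>j::int. b6 (n - 3 * j * (3 * j - 1) div 2)"
  let ?J = "{j. ?e j \<le> N}"
  let ?c = "\<lambda>m. card (partitions_into {s. \<not> 6 dvd s} m)"
  have J: "finite ?J" by (rule finite_theta_exponent_le) auto
  have b6_J: "b6 (n - 3 * j * (3 * j - 1) div 2) = ?c (N - ?e j)" if "j \<in> ?J" for j
  proof -
    have "n - 3 * j * (3 * j - 1) div 2 = int (N - ?e j)"
      using that by (simp add: n theta_exponent_9_3[symmetric] of_nat_diff)
    then show ?thesis by (simp only: b6_eq)
  qed
  \<comment> \<open>Outside \<open>?J\<close> the argument of \<open>b6\<close> is negative, so the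
    sum over all integers reduces to the finite set \<open>?J\<close>.\<close>
  have "{j. b6 (n - 3 * j * (3 * j - 1) div 2) \<noteq> 0} \<subseteq> ?J"
  proof
    fix j assume "j \<in> {j. b6 (n - 3 * j * (3 * j - 1) div 2) \<noteq> 0}"
    then have "b6 (n - 3 * j * (3 * j - 1) div 2) \<noteq> 0" ..
    then have "\<not> n - 3 * j * (3 * j - 1) div 2 < 0"
      by (rule contrapos_nn) (rule b6_neg)
    then show "j \<in> ?J"
      by (simp add: n flip: theta_exponent_9_3)
  qed
  then have "?S = (\<Sum>j\<in>?J. b6 (n - 3 * j * (3 * j - 1) div 2))"
    by (rule Sum_any.expand_superset[OF J])
  also have "\<dots> = (\<Sum>j\<in>?J. ?c (N - ?e j))"
    by (intro sum.cong refl b6_J)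
  \<comment> \<open>Grouping the \<open>j\<close> by exponent produces the Cauchy product of the two
    series at order \<open>N\<close>.\<close>
  also have "\<dots> = (\<Sum>i=0..N. \<Sum>j | j \<in> ?J \<and> ?e j = i. ?c (N - ?e j))"
    by (rule sum.group[symmetric]) (use J in auto)
  also have "\<dots> = (\<Sum>i=0..N. card {j. ?e j = i} * ?c (N - i))"
  proof (intro sum.cong refl)
    fix i assume "i \<in> {0..N}"
    then have "{j. j \<in> ?J \<and> ?e j = i} = {j. ?e j = i}" by auto
    then show "(\<Sum>j | j \<in> ?J \<and> ?e j = i. ?c (N - ?e j)) = card {j. ?e j = i} * ?c (N - i)"
      by simp
  qed
  finally have "of_nat ?S = (theta_series 9 3 * partition_series {s. \<not> 6 dvd s} :: bit fps) $ N"
    by (simp add: fps_mult_nth theta_series_def partition_series_def)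
  also have "\<dots> = (theta_series 6 1 :: bit fps) $ N"
    by (subst mult.commute) (simp only: partition_series_6_regular_mult_theta)
  also have "\<dots> = of_nat (card {k. theta_exponent 6 1 k = N})"
    by (simp add: theta_series_def)
  finally have parity: "odd ?S \<longleftrightarrow> odd (card {k. theta_exponent 6 1 k = N})"
    by (simp only: flip: of_nat_bit)
  have oct: "{k. theta_exponent 6 1 k = N} = {k. n = k * (3 * k - 2)}"
    by (auto simp: n theta_exponent_6_1[symmetric])
  have "odd (card {k. n = k * (3 * k - 2)}) \<longleftrightarrow> generalized_octagonal n"
  proof (cases "generalized_octagonal n")
    case True
    then obtain k where "n = k * (3 * k - 2)" by (auto simp: generalized_octagonal_def)
    then have "n = i * (3 * i - 2) \<longleftrightarrow> i = k" for i
      by (simp only: octagonal_eq_iff eq_commute[of k])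
    then have "{k. n = k * (3 * k - 2)} = {k}"
      by (simp only: singleton_conv)
    with True show ?thesis by simp
  next
    case False
    then have "{k. n = k * (3 * k - 2)} = {}" by (auto simp: generalized_octagonal_def)
    with False show ?thesis by simp
  qed
  with parity oct show ?thesis
    by (simp add: cong_def odd_iff_mod_2_eq_one)
qed

end
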